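(* Let $G$ be a finite simple connected graph with edges $e_1,\dots,e_m$, let $x\in P(G)$, and let $\mu>0$ be a simple (multiplicity one) eigenvalue of the Laplacian of the weighted graph $G(x)$, with corresponding eigenvector $f:V(G)\to\mathbf{R}$. Then $\mu$ is critical if and only if there is a constant $c$ such that $|f(u)-f(v)|=c$ for every edge $(uv)$ of $G$.
   Context: The weighted edge polytope is $P(G)=\{(x_1,\dots,x_m): x_j\ge 0,\ \sum_{j=1}^m x_j=m\}$; $G(x)$ is $G$ with weight $x_j$ on $e_j$. The Laplacian $\mathbf{L}(x)$ of $G(x)$ is the matrix with $L_{ii}$ equal to the sum of the weights of the edges at $v_i$, $L_{ij}=-x_k$ if $e_k=(v_iv_j)$ is an edge, and $L_{ij}=0$ if $i\neq j$ and $v_i,v_j$ are not adjacent. For $y\in\mathbf{R}^m$ with $\sum_j y_j=0$, consider the linear family of matrices $\mathbf{L}(x+ty)=\mathbf{L}(x)+tB$ (with $\mathbf L$ defined by the same formula for arbitrary real weights); near $t=0$ the simple eigenvalue $\mu$ extends to an analytic eigenvalue branch $\mu(t)$ with $\mu(0)=\mu$. The simple eigenvalue $\mu$ is called critical if $\mu'(0)=0$ for every such $y$; equivalently, $\langle Bf,f\rangle=0$ for every such $B$. *)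

theory Defs
  imports "HOL-Analysis.Analysis"
begin

text \<open>
  A graph has vertex set the finite type \<open>'v\<close> and edge set \<open>E :: 'v set set\<close>, an edge being
  the set of its two endpoints. A point of \<open>\<real>\<^sup>m\<close>, with one coordinate for each of the \<open>m = card E\<close>
  edges, is a function on edges; its values outside \<open>E\<close> are never used.
\<close>

definition simple_graph :: "'v::finite set set \<Rightarrow> bool" where
  "simple_graph E \<longleftrightarrow> (\<forall>e\<in>E. card e = 2)"

definition connected_graph :: "'v::finite set set \<Rightarrow> bool" where
  "connected_graph E \<longleftrightarrow> (\<forall>u v. (u, v) \<in> {(a, b). {a, b} \<in> E}\<^sup>*)"

definition edge_polytope :: "'v::finite set set \<Rightarrow> ('v set \<Rightarrow> real) set" where
  "edge_polytope E = {x. (\<forall>e\<in>E. 0 \<le> x e) \<and> (\<Sum>e\<in>E. x e) = real (card E)}"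

definition laplacian :: "'v::finite set set \<Rightarrow> ('v set \<Rightarrow> real) \<Rightarrow> real ^ 'v ^ 'v" where
  "laplacian E w = (\<chi> i j.
     if i = j then (\<Sum>e | e \<in> E \<and> i \<in> e. w e)
     else if {i, j} \<in> E then - w {i, j}
     else 0)"

definition eigenvector :: "real ^ 'n ^ 'n \<Rightarrow> real \<Rightarrow> real ^ 'n \<Rightarrow> bool" where
  "eigenvector A \<mu> f \<longleftrightarrow> f \<noteq> 0 \<and> A *v f = \<mu> *\<^sub>R f"

definition eigenvalue :: "real ^ 'n ^ 'n \<Rightarrow> real \<Rightarrow> bool" where
  "eigenvalue A \<mu> \<longleftrightarrow> (\<exists>f. eigenvector A \<mu> f)"

text \<open>
  Multiplicity is the dimension of the eigenspace. It is only used for the symmetric matrices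
  \<^term>\<open>laplacian E x\<close>, where it agrees with the multiplicity as a root of the
  characteristic polynomial.
\<close>

definition simple_eigenvalue :: "real ^ 'n ^ 'n \<Rightarrow> real \<Rightarrow> bool" where
  "simple_eigenvalue A \<mu> \<longleftrightarrow> dim {f. A *v f = \<mu> *\<^sub>R f} = 1"

text \<open>
  Real analyticity at \<open>0\<close> is expressed as having a power series expansion there with positive
  radius of convergence. Only the germ of \<open>b\<close> at \<open>0\<close> matters.
\<close>

definition eigenvalue_branch ::
  "'v::finite set set \<Rightarrow> ('v set \<Rightarrow> real) \<Rightarrow> ('v set \<Rightarrow> real) \<Rightarrow> real \<Rightarrow> (real \<Rightarrow> real) \<Rightarrow> bool" where
  "eigenvalue_branch E x y \<mu> b \<longleftrightarrow>
     (\<exists>F. b has_fps_expansion F) \<and> b 0 = \<mu> \<and>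
     (\<forall>\<^sub>F t in nhds 0. eigenvalue (laplacian E (\<lambda>e. x e + t * y e)) (b t))"

text \<open>
  If \<open>\<mu>\<close> is a simple eigenvalue of \<^term>\<open>laplacian E x\<close>, an analytic branch through \<open>\<mu>\<close> exists
  and its germ is unique, so the choice of \<open>b\<close> does not matter.
\<close>

definition critical :: "'v::finite set set \<Rightarrow> ('v set \<Rightarrow> real) \<Rightarrow> real \<Rightarrow> bool" where
  "critical E x \<mu> \<longleftrightarrow>
     (\<forall>y. (\<Sum>e\<in>E. y e) = 0 \<longrightarrow>
        (\<exists>b. eigenvalue_branch E x y \<mu> b \<and> (b has_real_derivative 0) (at 0)))"

end

theory Submission
  imports Defs
begin

text \<open>
  With \<open>B\<close> the Laplacian of \<open>y\<close> one has \<open>\<langle>B f, f\<rangle> = \<Sum>\<^sub>e y e * d e\<close>, where \<open>d {u, v} = (f u - f v)\<^sup>2\<close>;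
  this vanishes for all \<open>y\<close> of sum zero iff \<open>d\<close> is constant on the edges. So the theorem
  amounts to \<open>\<mu>' 0 = \<langle>B f, f\<rangle>\<close> for unit \<open>f\<close>, together with the existence of an analytic branch.
  For existence, the eigenvector is sought as a power series \<open>\<Sum>\<^sub>n t\<^sup>n g n\<close> with \<open>g 0 = f\<close> and
  \<open>g n\<close> orthogonal to \<open>f\<close> for \<open>n > 0\<close>; the coefficients are determined recursively, and a
  quadratic majorant shows that the series converges. Conversely, for an arbitrary branch with
  derivative zero, unit eigenvectors along a sequence \<open>t\<^sub>n \<longlonglongrightarrow> 0\<close> accumulate at a multiple of \<open>f\<close>.
\<close>

section \<open>Linear algebra of a simple eigenvalue\<close>

text \<open>The eigenspace contains the line through \<open>f\<close> and has the same
  dimension.\<close>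

lemma simple_eigenspace_eq_span:
  fixes A :: "real ^ 'n ^ 'n"
  assumes "simple_eigenvalue A \<mu>" "eigenvector A \<mu> f"
  shows "A *v v = \<mu> *\<^sub>R v \<longleftrightarrow> (\<exists>c. v = c *\<^sub>R f)"
proof -
  let ?V = "{v. A *v v = \<mu> *\<^sub>R v}"
  have f: "f \<noteq> 0" "A *v f = \<mu> *\<^sub>R f"
    using assms(2) by (auto simp: eigenvector_def)
  have sub: "subspace ?V"
    by (auto simp: subspace_def matrix_vector_right_distrib matrix_vector_mult_scaleR
        scaleR_add_right)
  have "span {f} = span ?V"
  proof (rule subspace_dim_equal)
    show "span {f} \<subseteq> span ?V" using f by (intro span_mono) auto
    show "dim (span {f}) \<ge> dim (span ?V)"
      using assms(1) f(1) by (simp add: simple_eigenvalue_def dim_singleton)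
  qed auto
  moreover have "span ?V = ?V" using sub by (simp only: span_eq_iff)
  ultimately have "?V = span {f}" by metis
  thus ?thesis by (auto simp: span_singleton)
qed

lemma symmetric_matrix_inner:
  fixes A :: "real ^ 'n ^ 'n"
  assumes "transpose A = A"
  shows "(A *v v) \<bullet> w = v \<bullet> (A *v w)"
  by (metis assms dot_lmul_matrix transpose_matrix_vector)

text \<open>
  Coefficients of \<open>t\<^sup>n\<close> in an eigenvector of \<open>A + t B\<close>, normalised so that its inner product with
  the unit vector \<open>f\<close> is 1. The eigenvalue then has coefficients \<open>\<langle>B g n, f\<rangle>\<close> at \<open>t\<^sup>n\<^sup>+\<^sup>1\<close>. Below, \<open>S\<close>
  is the inverse of \<open>A - \<mu>\<close> plus the orthogonal projection onto \<open>f\<close>.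
\<close>

fun eigenvector_coeff ::
  "(real ^ 'n \<Rightarrow> real ^ 'n) \<Rightarrow> real ^ 'n ^ 'n \<Rightarrow> real ^ 'n \<Rightarrow> nat \<Rightarrow> real ^ 'n" where
  "eigenvector_coeff S B f 0 = f"
| "eigenvector_coeff S B f (Suc n) =
     S ((\<Sum>k\<le>n. ((B *v eigenvector_coeff S B f k) \<bullet> f) *\<^sub>R eigenvector_coeff S B f (n - k))
        - B *v eigenvector_coeff S B f n)"

section \<open>Majorants and radii of convergence\<close>

text \<open>With \<open>r = 1 / (4 * C)\<close>, the partial sums \<open>s N\<close> of
  \<open>a n * r ^ n\<close> satisfy \<open>s (Suc N) \<le> 1 + (s N)\<^sup>2 / 4\<close>. Since 2
  is a fixed point of the right-hand side, the bound reproduces itself.\<close>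

lemma sum_quadratic_recurrence_le_2:
  fixes a :: "nat \<Rightarrow> real"
  assumes nonneg: "\<And>n. a n \<ge> 0" and a0: "a 0 = 1" and C: "C > 0"
    and rec: "\<And>n. a (Suc n) \<le> C * (\<Sum>k\<le>n. a k * a (n - k))"
  shows "(\<Sum>n\<le>N. a n * (1 / (4 * C)) ^ n) \<le> 2"
proof (induction N)
  case 0
  show ?case by (simp add: a0)
next
  case (Suc N)
  define r where "r = 1 / (4 * C)"
  have r: "r > 0" "r * C = 1 / 4" using C by (auto simp: r_def)
  let ?b = "\<lambda>n. a n * r ^ n"
  have b0: "?b n \<ge> 0" for n using nonneg r by simp
  have "(\<Sum>n\<le>N. ?b (Suc n)) \<le> (\<Sum>n\<le>N. (1/4) * (\<Sum>k\<le>n. ?b k * ?b (n - k)))"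
  proof (rule sum_mono)
    fix n
    have "?b (Suc n) \<le> (C * (\<Sum>k\<le>n. a k * a (n - k))) * r ^ Suc n"
      using rec r by (intro mult_right_mono) auto
    also have "\<dots> = (r * C) * (\<Sum>k\<le>n. a k * a (n - k) * r ^ n)"
      by (simp flip: sum_distrib_right)
    also have "(\<Sum>k\<le>n. a k * a (n - k) * r ^ n) = (\<Sum>k\<le>n. ?b k * ?b (n - k))"
      by (intro sum.cong) (auto simp: power_add [symmetric])
    finally show "?b (Suc n) \<le> (1/4) * (\<Sum>k\<le>n. ?b k * ?b (n - k))" by (simp add: r)
  qed
  also have "\<dots> = (1/4) * (\<Sum>(k, j)\<in>(SIGMA n:{..N}. {..n}). ?b j * ?b (k - j))"
    by (simp only: sum_distrib_left [symmetric]) (simp add: sum.Sigma)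
  \<comment> \<open>Sending \<open>(k, j)\<close> to \<open>(j, k - j)\<close> turns the
    convolutions into a sum over pairs with index sum at most \<open>N\<close>. As the terms are
    nonnegative, this triangle can then be enlarged to a square.\<close>
  also have "(\<Sum>(k, j)\<in>(SIGMA n:{..N}. {..n}). ?b j * ?b (k - j))
      = (\<Sum>(i, j)\<in>(\<lambda>(k, j). (j, k - j)) ` (SIGMA n:{..N}. {..n}). ?b i * ?b j)"
    by (subst sum.reindex) (auto simp: inj_on_def case_prod_unfold)
  also have "\<dots> \<le> (\<Sum>(i, j)\<in>{..N} \<times> {..N}. ?b i * ?b j)"
    by (rule sum_mono2) (use nonneg r in auto)
  also have "\<dots> = (\<Sum>i\<le>N. ?b i) * (\<Sum>i\<le>N. ?b i)"
    by (simp add: sum_product sum.cartesian_product)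
  also have "\<dots> \<le> 2 * 2"
    using Suc b0 unfolding r_def [symmetric] by (intro mult_mono sum_nonneg) auto
  finally have "(\<Sum>n\<le>N. ?b (Suc n)) \<le> 1" by simp
  moreover have "(\<Sum>n\<le>Suc N. ?b n) = 1 + (\<Sum>n\<le>N. ?b (Suc n))"
    by (subst sum.atMost_Suc_shift) (simp add: a0)
  ultimately show ?case unfolding r_def by simp
qed

text \<open>At every \<open>s\<close> with \<open>0 < s < r\<close> a geometric series of ratio
  \<open>s / r\<close> dominates.\<close>

lemma fps_conv_radius_ge_of_bounded_terms:
  fixes F :: "real fps"
  assumes "r > 0" "\<And>n. \<bar>fps_nth F n\<bar> * r ^ n \<le> K"
  shows "fps_conv_radius F \<ge> ereal r"
  unfolding fps_conv_radius_def
proof (rule conv_radius_geI_ex')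
  fix s :: real
  assume s: "0 < s" "ereal s < ereal r"
  show "summable (\<lambda>n. fps_nth F n * of_real s ^ n)"
  proof (rule summable_comparison_test')
    show "summable (\<lambda>n. K * (s / r) ^ n)"
      using s by (intro summable_mult summable_geometric) auto
    fix n
    have "norm (fps_nth F n * of_real s ^ n) = (\<bar>fps_nth F n\<bar> * r ^ n) * (s / r) ^ n"
      using s assms(1) by (simp add: abs_mult power_divide)
    also have "\<dots> \<le> K * (s / r) ^ n"
      using s assms by (intro mult_right_mono) auto
    finally show "norm (fps_nth F n * of_real s ^ n) \<le> K * (s / r) ^ n" .
  qed
qed

section \<open>Existence of the analytic branch\<close>

text \<open>Comparing coefficients of \<open>t\<^sup>n\<^sup>+\<^sup>1\<close> in the eigenvalue
  equation prescribes \<open>A - \<mu>\<close> applied to \<open>g (Suc n)\<close>. As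
  \<open>A\<close> is symmetric, the range of \<open>A - \<mu>\<close> is orthogonal to
  \<open>f\<close>; this forces the eigenvalue coefficient \<open>l n\<close>, and the derivative at
  0 is \<open>l 0\<close>.\<close>

lemma analytic_eigenvalue_branch:
  fixes A B :: "real ^ 'n ^ 'n"
  assumes sym: "transpose A = A" and simple: "simple_eigenvalue A \<mu>"
    and ev: "eigenvector A \<mu> f" and nf: "norm f = 1"
  shows "\<exists>b. (\<exists>F. b has_fps_expansion F) \<and> b 0 = \<mu> \<and>
    (\<forall>\<^sub>F t in nhds 0. eigenvalue (A + t *\<^sub>R B) (b t)) \<and>
    (b has_real_derivative (B *v f) \<bullet> f) (at 0)"
proof -
  have f: "A *v f = \<mu> *\<^sub>R f" "f \<noteq> 0" "f \<bullet> f = 1"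
    using ev nf by (auto simp: eigenvector_def norm_eq_1)
  have Af: "(A *v v) \<bullet> f = \<mu> * (v \<bullet> f)" for v
    by (simp add: symmetric_matrix_inner [OF sym] f(1))
  \<comment> \<open>Adding the projection onto \<open>f\<close> makes \<open>A - \<mu>\<close>
    invertible without changing it on vectors orthogonal to \<open>f\<close>.\<close>
  define M where "M = (\<lambda>v. A *v v - \<mu> *\<^sub>R v + (v \<bullet> f) *\<^sub>R f)"
  have Mf: "M v \<bullet> f = v \<bullet> f" for v
    by (simp add: M_def inner_add_left inner_diff_left Af f)
  have linM: "linear M"
    unfolding M_def
    by (auto intro!: linearI simp: matrix_vector_right_distrib matrix_vector_mult_scaleR
        algebra_simps inner_add_left)
  have "inj M"
  proof (rule linear_injective_0 [OF linM, THEN iffD2], intro allI impI)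
    fix v assume v: "M v = 0"
    hence vf: "v \<bullet> f = 0" using Mf [of v] by simp
    hence "A *v v = \<mu> *\<^sub>R v" using v by (simp add: M_def)
    then obtain c where "v = c *\<^sub>R f" using simple_eigenspace_eq_span [OF simple ev] by blast
    thus "v = 0" using vf f by simp
  qed
  then obtain S where linS: "linear S" and MS: "\<And>v. M (S v) = v"
    using linear_injective_isomorphism [OF linM] by blast
  define g where "g = eigenvector_coeff S B f"
  define l where "l = (\<lambda>n. (B *v g n) \<bullet> f)"
  have g0: "g 0 = f"
    and gS: "g (Suc n) = S ((\<Sum>k\<le>n. l k *\<^sub>R g (n - k)) - B *v g n)" for n
    by (simp_all add: g_def l_def)
  have gf: "g n \<bullet> f = (if n = 0 then 1 else 0)" for n
  proof (induction n rule: less_induct)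
    case (less n)
    show ?case
    proof (cases n)
      case 0 thus ?thesis by (simp add: g0 f)
    next
      case (Suc m)
      have "g n \<bullet> f = M (g n) \<bullet> f" by (simp add: Mf)
      also have "\<dots> = (\<Sum>k\<le>m. l k * (g (m - k) \<bullet> f)) - l m"
        by (simp add: Suc gS MS inner_diff_left inner_sum_left l_def)
      \<comment> \<open>By the induction hypothesis only \<open>k = m\<close> survives, and its
        contribution cancels \<open>l m\<close>.\<close>
      also have "(\<Sum>k\<le>m. l k * (g (m - k) \<bullet> f)) = (\<Sum>k\<le>m. if k = m then l k else 0)"
        using less Suc by (intro sum.cong) auto
      finally show ?thesis using Suc by simp
    qed
  qed
  have rec: "A *v g (Suc n) + B *v g n = \<mu> *\<^sub>R g (Suc n) + (\<Sum>k\<le>n. l k *\<^sub>R g (n - k))" for n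
  proof -
    have "M (g (Suc n)) = (\<Sum>k\<le>n. l k *\<^sub>R g (n - k)) - B *v g n" by (simp add: gS MS)
    thus ?thesis using gf [of "Suc n"] by (simp add: M_def algebra_simps)
  qed
  obtain K where K: "K > 0" "\<And>v. norm (S v) \<le> K * norm v"
    using linear_bounded_pos [OF linS] by blast
  obtain D where D: "D > 0" "\<And>v. norm (B *v v) \<le> D * norm v"
    using linear_bounded_pos [OF matrix_vector_mul_linear [of B]] by blast
  \<comment> \<open>Half of the factor 2 pays for the convolution, half for \<open>B *v g n\<close>:
    as \<open>norm (g 0) = 1\<close>, \<open>norm (g n)\<close> is itself the term
    \<open>k = 0\<close> of the convolution of norms.\<close>
  define C where "C = 2 * K * D"
  have C: "C > 0" using K D by (simp add: C_def)
  have l_le: "\<bar>l n\<bar> \<le> D * norm (g n)" for n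
    using Cauchy_Schwarz_ineq2 [of "B *v g n" f] D(2) [of "g n"] nf by (simp add: l_def)
  have "norm (g (Suc n)) \<le> C * (\<Sum>k\<le>n. norm (g k) * norm (g (n - k)))" for n
  proof -
    let ?s = "\<Sum>k\<le>n. norm (g k) * norm (g (n - k))"
    have "norm (\<Sum>k\<le>n. l k *\<^sub>R g (n - k)) \<le> (\<Sum>k\<le>n. D * (norm (g k) * norm (g (n - k))))"
    proof (rule sum_norm_le)
      fix k
      show "norm (l k *\<^sub>R g (n - k)) \<le> D * (norm (g k) * norm (g (n - k)))"
        using mult_right_mono [OF l_le [of k], of "norm (g (n - k))"] by (simp add: mult.assoc)
    qed
    hence 1: "norm (\<Sum>k\<le>n. l k *\<^sub>R g (n - k)) \<le> D * ?s"
      by (simp add: sum_distrib_left)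
    have "norm (g 0) * norm (g (n - 0)) \<le> ?s" by (rule member_le_sum) auto
    hence "norm (g n) \<le> ?s" by (simp add: g0 nf)
    hence "D * norm (g n) \<le> D * ?s"
      using D(1) by (intro mult_left_mono) auto
    hence 2: "norm (B *v g n) \<le> D * ?s"
      by (rule order_trans [OF D(2)])
    have "norm (g (Suc n)) \<le> K * norm ((\<Sum>k\<le>n. l k *\<^sub>R g (n - k)) - B *v g n)"
      unfolding gS by (rule K(2))
    also have "\<dots> \<le> K * (D * ?s + D * ?s)"
      using K(1) 1 2 by (intro mult_left_mono order_trans [OF norm_triangle_ineq4] add_mono) auto
    also have "\<dots> = C * ?s" by (simp add: C_def)
    finally show ?thesis .
  qed
  hence sums: "(\<Sum>n\<le>N. norm (g n) * (1 / (4 * C)) ^ n) \<le> 2" for N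
    using C nf by (intro sum_quadratic_recurrence_le_2) (auto simp: g0)
  define r where "r = 1 / (4 * C)"
  have r: "r > 0" using C by (simp add: r_def)
  have g_le: "norm (g n) * r ^ n \<le> 2" for n
  proof -
    have "norm (g n) * r ^ n \<le> (\<Sum>n\<le>n. norm (g n) * r ^ n)"
      using r by (intro member_le_sum) auto
    thus ?thesis using sums [of n] by (simp add: r_def)
  qed
  \<comment> \<open>The eigenvector series is treated one coordinate at a time. In \<open>F\<close>,
    the factor \<open>fps_X\<close> moves \<open>l n\<close> to degree \<open>n + 1\<close>.\<close>
  define G where "G = (\<lambda>i. Abs_fps (\<lambda>n. g n $ i))"
  define F where "F = fps_const \<mu> + fps_X * Abs_fps l"
  have G_rad: "fps_conv_radius (G i) \<ge> r" for i
  proof (rule fps_conv_radius_ge_of_bounded_terms [OF r])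
    fix n
    have "\<bar>g n $ i\<bar> * r ^ n \<le> norm (g n) * r ^ n"
      using component_le_norm_cart r by (intro mult_right_mono) auto
    thus "\<bar>fps_nth (G i) n\<bar> * r ^ n \<le> 2" using g_le [of n] by (simp add: G_def)
  qed
  have l_rad: "fps_conv_radius (Abs_fps l) \<ge> r"
  proof (rule fps_conv_radius_ge_of_bounded_terms [OF r])
    fix n
    have "\<bar>l n\<bar> * r ^ n \<le> (D * norm (g n)) * r ^ n"
      using l_le r by (intro mult_right_mono) auto
    also have "\<dots> \<le> D * 2" using g_le [of n] D by (simp add: mult.assoc)
    finally show "\<bar>fps_nth (Abs_fps l) n\<bar> * r ^ n \<le> D * 2" by simp
  qed
  have X_rad: "fps_conv_radius (fps_X * H) \<ge> r" if "fps_conv_radius H \<ge> r" for H :: "real fps"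
    using that fps_conv_radius_mult [of fps_X H] by (simp add: min_def)
  have c_rad: "fps_conv_radius (fps_const c * H) \<ge> r" if "fps_conv_radius H \<ge> r"
    for H :: "real fps" and c
    using that fps_conv_radius_mult [of "fps_const c" H] by (simp add: min_def)
  have F_rad: "fps_conv_radius F \<ge> r"
    using fps_conv_radius_add [of "fps_const \<mu>" "fps_X * Abs_fps l"] X_rad [OF l_rad]
    by (simp add: F_def min_def)
  \<comment> \<open>Additivity of evaluation is applied inside the discs of convergence, so the
    induction carries the radius bound along.\<close>
  have eval_sum: "fps_conv_radius (\<Sum>j\<in>J. H j) \<ge> r \<and>
      (\<forall>t. \<bar>t\<bar> < r \<longrightarrow> eval_fps (\<Sum>j\<in>J. H j) t = (\<Sum>j\<in>J. eval_fps (H j) t))"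
    if "finite J" "\<And>j. j \<in> J \<Longrightarrow> fps_conv_radius (H j) \<ge> r" for J :: "'n set" and H :: "'n \<Rightarrow> real fps"
    using that
  proof (induction J rule: finite_induct)
    case empty
    thus ?case by simp
  next
    case (insert j J)
    hence IH: "fps_conv_radius (\<Sum>j\<in>J. H j) \<ge> r" "fps_conv_radius (H j) \<ge> r" by auto
    hence "fps_conv_radius (H j + (\<Sum>j\<in>J. H j)) \<ge> r"
      using fps_conv_radius_add [of "H j" "\<Sum>j\<in>J. H j"] by (meson min.boundedI order_trans)
    moreover have "eval_fps (H j + (\<Sum>j\<in>J. H j)) t = eval_fps (H j) t + eval_fps (\<Sum>j\<in>J. H j) t"
      if "\<bar>t\<bar> < r" for t
      using IH that by (intro eval_fps_add) (auto intro: less_le_trans [of _ "ereal r"])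
    ultimately show ?case using insert by auto
  qed
  \<comment> \<open>Row \<open>i\<close> of the eigenvalue equation, still formal: degree 0 is the
    equation for \<open>f\<close>, degree \<open>m + 1\<close> is \<open>rec\<close>.\<close>
  have series: "(\<Sum>j\<in>UNIV. fps_const (A $ i $ j) * G j) + fps_X * (\<Sum>j\<in>UNIV. fps_const (B $ i $ j) * G j)
      = F * G i" for i
  proof (rule fps_ext)
    fix n
    show "fps_nth ((\<Sum>j\<in>UNIV. fps_const (A $ i $ j) * G j) +
        fps_X * (\<Sum>j\<in>UNIV. fps_const (B $ i $ j) * G j)) n = fps_nth (F * G i) n"
    proof (cases n)
      case 0
      have "(A *v f) $ i = \<mu> * f $ i" by (simp add: f)
      thus ?thesis
        by (simp add: 0 F_def G_def g0 fps_sum_nth matrix_vector_mult_def)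
    next
      case (Suc m)
      have "(A *v g (Suc m)) $ i + (B *v g m) $ i
          = \<mu> * g (Suc m) $ i + (\<Sum>k\<le>m. l k * g (m - k) $ i)"
        using arg_cong [OF rec [of m], of "\<lambda>v. v $ i"] by simp
      thus ?thesis
        by (simp add: Suc F_def G_def fps_sum_nth matrix_vector_mult_def distrib_right
            mult.assoc fps_mult_nth [of "Abs_fps l"] atLeast0AtMost)
    qed
  qed
  define h where "h = (\<lambda>t. \<chi> i. eval_fps (G i) t)"
  have h: "(A + t *\<^sub>R B) *v h t = eval_fps F t *\<^sub>R h t" if t: "\<bar>t\<bar> < r" for t
  proof -
    have lt: "ereal (norm t) < R" if "R \<ge> ereal r" for R
      using t that by (auto intro: less_le_trans [of _ "ereal r"])
    have const: "eval_fps (fps_const c * G j) t = c * eval_fps (G j) t" for c j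
      using lt [OF G_rad] by (subst eval_fps_mult) auto
    have AG: "fps_conv_radius (\<Sum>j\<in>UNIV. fps_const (P $ i $ j) * G j) \<ge> r"
      "eval_fps (\<Sum>j\<in>UNIV. fps_const (P $ i $ j) * G j) t = (P *v h t) $ i"
      for P :: "real ^ 'n ^ 'n" and i
      using eval_sum [of UNIV "\<lambda>j. fps_const (P $ i $ j) * G j"] c_rad [OF G_rad] t
      by (auto simp: const h_def matrix_vector_mult_def)
    have "(A *v h t) $ i + t * (B *v h t) $ i = eval_fps F t * h t $ i" for i
    proof -
      have "(A *v h t) $ i + t * (B *v h t) $ i
          = eval_fps ((\<Sum>j\<in>UNIV. fps_const (A $ i $ j) * G j) +
              fps_X * (\<Sum>j\<in>UNIV. fps_const (B $ i $ j) * G j)) t"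
        by (subst eval_fps_add; (intro lt AG X_rad)?) (subst eval_fps_mult;
          (intro lt AG)?; simp add: AG)
      also have "\<dots> = eval_fps F t * h t $ i"
        by (simp add: series eval_fps_mult [OF lt [OF F_rad] lt [OF G_rad]] h_def)
      finally show ?thesis .
    qed
    thus ?thesis
      by (simp add: vec_eq_iff matrix_vector_mult_add_rdistrib scaleR_matrix_vector_assoc [symmetric])
  qed
  \<comment> \<open>To be an eigenvector, \<open>h t\<close> must be nonzero; a nonzero coordinate
    of \<open>f\<close> stays nonzero near 0 by continuity.\<close>
  obtain i where i: "f $ i \<noteq> 0" using f(2) by (auto simp: vec_eq_iff)
  have "isCont (eval_fps (G i)) 0"
    using G_rad [of i] r
    by (intro continuous_eval_fps) (auto simp: less_le_trans [of _ "ereal r"] zero_ereal_def)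
  moreover have "eval_fps (G i) 0 \<noteq> 0" using i by (simp add: eval_fps_at_0 G_def g0)
  ultimately have "\<forall>\<^sub>F t in nhds 0. eval_fps (G i) t \<noteq> 0"
    by (simp add: continuous_within tendsto_imp_eventually_ne eventually_nhds_conv_at)
  moreover have "\<forall>\<^sub>F t in nhds 0. \<bar>t\<bar> < r"
    using r by (auto simp: eventually_nhds_metric dist_real_def)
  ultimately have "\<forall>\<^sub>F t in nhds 0. eigenvalue (A + t *\<^sub>R B) (eval_fps F t)"
  proof eventually_elim
    case (elim t)
    hence "h t \<noteq> 0" by (auto simp: h_def vec_eq_iff)
    thus ?case using h [of t] elim unfolding eigenvalue_def eigenvector_def by blast
  qed
  moreover have pos: "fps_conv_radius F > 0"
    using F_rad r by (auto simp: less_le_trans [of _ "ereal r"] zero_ereal_def)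
  moreover have "eval_fps F 0 = \<mu>" by (simp add: eval_fps_at_0 F_def)
  moreover have "(eval_fps F has_real_derivative (B *v f) \<bullet> f) (at 0)"
  proof -
    have "(eval_fps F has_real_derivative eval_fps (fps_deriv F) 0) (at 0)"
      using pos by (intro has_field_derivative_eval_fps) (simp add: zero_ereal_def)
    thus ?thesis by (simp add: eval_fps_at_0 F_def l_def g0)
  qed
  ultimately show ?thesis
    by (intro exI [of _ "eval_fps F"]) (auto intro!: exI [of _ F] simp: has_fps_expansion_def)
qed

section \<open>Stationary branches\<close>

text \<open>Pairing the eigenvalue equation with \<open>f\<close> and using the symmetry of
  \<open>A\<close> shows that \<open>(B *v h n) \<bullet> f\<close> is the difference quotient of
  \<open>b\<close> times \<open>h n \<bullet> f\<close>. Compactness of the unit sphere supplies the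
  limit, without a continuous choice of eigenvectors.\<close>

lemma eigenvalue_branch_stationary:
  fixes A B :: "real ^ 'n ^ 'n"
  assumes sym: "transpose A = A" and simple: "simple_eigenvalue A \<mu>"
    and ev: "eigenvector A \<mu> f" and b0: "b 0 = \<mu>"
    and b: "\<forall>\<^sub>F t in nhds 0. eigenvalue (A + t *\<^sub>R B) (b t)"
    and deriv: "(b has_real_derivative 0) (at 0)"
  shows "(B *v f) \<bullet> f = 0"
proof -
  have f: "A *v f = \<mu> *\<^sub>R f" "f \<noteq> 0" using ev by (auto simp: eigenvector_def)
  have Af: "(A *v v) \<bullet> f = \<mu> * (v \<bullet> f)" for v
    by (simp add: symmetric_matrix_inner [OF sym] f(1))
  obtain d where d: "d > 0" "\<And>t. \<bar>t\<bar> < d \<Longrightarrow> eigenvalue (A + t *\<^sub>R B) (b t)"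
    using b by (auto simp: eventually_nhds_metric dist_real_def)
  \<comment> \<open>The shift by 2 keeps every \<open>t n\<close> strictly between 0 and
    \<open>d\<close>.\<close>
  define t where "t = (\<lambda>n. d / real (n + 2))"
  have t0: "t n > 0" "t n < d" for n using d by (auto simp: t_def field_simps intro!: add_pos_nonneg)
  have t_lim: "t \<longlonglongrightarrow> 0"
    unfolding t_def by (rule LIMSEQ_ignore_initial_segment [OF lim_const_over_n])
  have "\<exists>h. norm h = 1 \<and> (A + t n *\<^sub>R B) *v h = b (t n) *\<^sub>R h" for n
  proof -
    obtain h where "h \<noteq> 0" "(A + t n *\<^sub>R B) *v h = b (t n) *\<^sub>R h"
      using d(2) [of "t n"] t0 [of n] by (auto simp: eigenvalue_def eigenvector_def)
    thus ?thesis
      by (intro exI [of _ "h /\<^sub>R norm h"]) (auto simp: matrix_vector_mult_scaleR)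
  qed
  then obtain h where h: "\<And>n. norm (h n) = 1" "\<And>n. (A + t n *\<^sub>R B) *v h n = b (t n) *\<^sub>R h n"
    by metis
  have "compact (sphere (0 :: real ^ 'n) 1)" by simp
  then obtain k \<sigma> where k: "norm k = 1" "strict_mono \<sigma>" "(h \<circ> \<sigma>) \<longlonglongrightarrow> k"
    using h(1) unfolding compact_def by (metis dist_0_norm mem_sphere)
  have hk: "(\<lambda>n. h (\<sigma> n)) \<longlonglongrightarrow> k" using k(3) by (simp add: o_def)
  have ts: "(\<lambda>n. t (\<sigma> n)) \<longlonglongrightarrow> 0"
    using LIMSEQ_subseq_LIMSEQ [OF t_lim k(2)] by (simp add: o_def)
  have "isCont b 0" using deriv by (rule DERIV_isCont)
  hence bs: "(\<lambda>n. b (t (\<sigma> n))) \<longlonglongrightarrow> \<mu>" using isCont_tendsto_compose [OF _ ts] b0 by metis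
  have mv: "(\<lambda>n. P *v h (\<sigma> n)) \<longlonglongrightarrow> P *v k" for P :: "real ^ 'n ^ 'n"
    using hk by (intro bounded_linear.tendsto [OF matrix_vector_mul_bounded_linear])
  have eq: "A *v h n + t n *\<^sub>R (B *v h n) = b (t n) *\<^sub>R h n" for n
    using h(2) [of n] by (simp add: matrix_vector_mult_add_rdistrib scaleR_matrix_vector_assoc)
  have "(\<lambda>n. A *v h (\<sigma> n) + t (\<sigma> n) *\<^sub>R (B *v h (\<sigma> n))) \<longlonglongrightarrow> A *v k + 0 *\<^sub>R (B *v k)"
    by (intro tendsto_intros mv ts)
  moreover have "(\<lambda>n. b (t (\<sigma> n)) *\<^sub>R h (\<sigma> n)) \<longlonglongrightarrow> \<mu> *\<^sub>R k"
    by (intro tendsto_intros bs hk)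
  ultimately have "A *v k = \<mu> *\<^sub>R k" unfolding eq by (auto dest: LIMSEQ_unique)
  then obtain c where c: "k = c *\<^sub>R f" using simple_eigenspace_eq_span [OF simple ev] by blast
  have quot: "(B *v h n) \<bullet> f = (b (t n) - b 0) / t n * (h n \<bullet> f)" for n
  proof -
    have "t n * ((B *v h n) \<bullet> f) = (b (t n) - \<mu>) * (h n \<bullet> f)"
      using arg_cong [OF eq [of n], of "\<lambda>v. v \<bullet> f"]
      by (simp add: inner_add_left Af algebra_simps)
    thus ?thesis using t0 [of n] b0 by (simp add: field_simps)
  qed
  have "((\<lambda>t. (b t - b 0) / t) \<longlongrightarrow> 0) (at 0)"
    using deriv by (simp add: has_field_derivative_iff)
  moreover have "filterlim (\<lambda>n. t (\<sigma> n)) (at 0) sequentially"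
    using ts t0 by (auto simp: filterlim_at less_imp_neq [symmetric] intro!: always_eventually)
  ultimately have "(\<lambda>n. (b (t (\<sigma> n)) - b 0) / t (\<sigma> n)) \<longlonglongrightarrow> 0"
    by (rule filterlim_compose)
  hence "(\<lambda>n. (b (t (\<sigma> n)) - b 0) / t (\<sigma> n) * (h (\<sigma> n) \<bullet> f)) \<longlonglongrightarrow> 0 * (k \<bullet> f)"
    by (intro tendsto_intros hk)
  moreover have "(\<lambda>n. (B *v h (\<sigma> n)) \<bullet> f) \<longlonglongrightarrow> (B *v k) \<bullet> f"
    by (intro tendsto_intros mv)
  ultimately have "(B *v k) \<bullet> f = 0" unfolding quot by (auto dest: LIMSEQ_unique)
  \<comment> \<open>The factor \<open>c\<close> is nonzero because \<open>k\<close> has norm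
    1.\<close>
  thus ?thesis using c k(1) by (auto simp: matrix_vector_mult_scaleR)
qed

section \<open>The Laplacian as a sum over edges\<close>

lemma transpose_laplacian: "transpose (laplacian E w) = laplacian E w"
  by (simp add: transpose_def laplacian_def vec_eq_iff insert_commute)

lemma laplacian_add_scaleR:
  "laplacian E (\<lambda>e. x e + t * y e) = laplacian E x + t *\<^sub>R laplacian E y"
  by (simp add: laplacian_def vec_eq_iff sum.distrib sum_distrib_left)

text \<open>An edge containing distinct \<open>i\<close> and \<open>j\<close> is
  \<open>{i, j}\<close>, so at most one term survives off the diagonal. With all entries summed over
  the same set \<open>E\<close>, the sum over edges can be pulled out of the quadratic form.\<close>

lemma laplacian_entry:
  fixes E :: "'v::finite set set"
  assumes "simple_graph E"
  shows "laplacian E y $ i $ j =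
    (\<Sum>e\<in>E. y e * (if i \<in> e \<and> j \<in> e then (if i = j then 1 else -1) else 0))"
proof (cases "i = j")
  case True
  have "(\<Sum>e | e \<in> E \<and> i \<in> e. y e) = (\<Sum>e\<in>E. if i \<in> e then y e else 0)"
    by (rule sum.inter_filter) simp
  also have "\<dots> = (\<Sum>e\<in>E. y e * (if i \<in> e then 1 else 0))"
    by (intro sum.cong) auto
  finally show ?thesis using True by (simp add: laplacian_def)
next
  case False
  have "i \<in> e \<and> j \<in> e \<longleftrightarrow> e = {i, j}" if "e \<in> E" for e
    using assms that False by (auto simp: simple_graph_def card_2_iff)
  hence "(\<Sum>e\<in>E. y e * (if i \<in> e \<and> j \<in> e then (if i = j then 1 else -1) else 0))
      = (\<Sum>e\<in>E. if e = {i, j} then - y e else 0)"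
    using False by (intro sum.cong) auto
  thus ?thesis using False by (simp add: laplacian_def)
qed

text \<open>Each edge contributes a two by two block with 1 on the diagonal and -1 off it, whose
  form is the squared difference. The squares enter as a function \<open>d\<close> on sets because
  an edge does not order its endpoints.\<close>

lemma laplacian_quadratic_form:
  fixes E :: "'v::finite set set"
  assumes simple: "simple_graph E" and d: "\<And>u v. {u, v} \<in> E \<Longrightarrow> d {u, v} = (f $ u - f $ v)\<^sup>2"
  shows "(laplacian E y *v f) \<bullet> f = (\<Sum>e\<in>E. y e * d e)"
proof -
  define q where "q = (\<lambda>e i j. (if i \<in> e \<and> j \<in> e then (if i = j then 1 else -1) else 0) * f $ j * f $ i)"
  have "(laplacian E y *v f) \<bullet> f = (\<Sum>i\<in>UNIV. \<Sum>j\<in>UNIV. laplacian E y $ i $ j * f $ j * f $ i)"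
    by (simp add: inner_vec_def matrix_vector_mult_def sum_distrib_right)
  also have "\<dots> = (\<Sum>i\<in>UNIV. \<Sum>j\<in>UNIV. \<Sum>e\<in>E. y e * q e i j)"
    by (simp only: laplacian_entry [OF simple] sum_distrib_right q_def mult.assoc)
  also have "\<dots> = (\<Sum>e\<in>E. \<Sum>i\<in>UNIV. \<Sum>j\<in>UNIV. y e * q e i j)"
    by (simp only: sum.swap [of _ E])
  also have "\<dots> = (\<Sum>e\<in>E. y e * d e)"
  proof (rule sum.cong [OF refl])
    fix e assume e: "e \<in> E"
    then obtain u v where uv: "e = {u, v}" "u \<noteq> v"
      using simple by (auto simp: simple_graph_def card_2_iff)
    have "(\<Sum>i\<in>UNIV. \<Sum>j\<in>UNIV. q e i j) = (\<Sum>i\<in>e. \<Sum>j\<in>UNIV. q e i j)"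
      by (rule sum.mono_neutral_right) (auto simp: q_def)
    also have "\<dots> = (\<Sum>i\<in>e. \<Sum>j\<in>e. q e i j)"
      by (intro sum.cong [OF refl] sum.mono_neutral_right) (auto simp: q_def)
    also have "\<dots> = (f $ u - f $ v)\<^sup>2"
      using uv by (simp add: q_def power2_eq_square algebra_simps)
    finally show "(\<Sum>i\<in>UNIV. \<Sum>j\<in>UNIV. y e * q e i j) = y e * d e"
      using d [of u v] e uv by (simp add: sum_distrib_left [symmetric])
  qed
  finally show ?thesis .
qed

section \<open>Criticality and differences along edges\<close>

theorem proposition2p6:
  fixes E :: "'v::finite set set"
    and x :: "'v set \<Rightarrow> real"
    and \<mu> :: real
    and f :: "real ^ 'v"
  assumes "simple_graph E"
    and "connected_graph E"
    and "x \<in> edge_polytope E"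
    and "\<mu> > 0"
    and "simple_eigenvalue (laplacian E x) \<mu>"
    and "eigenvector (laplacian E x) \<mu> f"
  shows "critical E x \<mu> \<longleftrightarrow>
    (\<exists>c. \<forall>u v. {u, v} \<in> E \<longrightarrow> \<bar>f $ u - f $ v\<bar> = c)"
proof -
  note simple = \<open>simple_eigenvalue (laplacian E x) \<mu>\<close>
    and ev = \<open>eigenvector (laplacian E x) \<mu> f\<close>
  \<comment> \<open>The identity \<open>2 * (a\<^sup>2 + b\<^sup>2) - (a + b)\<^sup>2 = (a -
    b)\<^sup>2\<close> expresses the squared difference without ordering the endpoints.\<close>
  define d where "d = (\<lambda>e. 2 * (\<Sum>i\<in>e. (f $ i)\<^sup>2) - (\<Sum>i\<in>e. f $ i)\<^sup>2)"
  have d: "d {u, v} = (f $ u - f $ v)\<^sup>2" if "{u, v} \<in> E" for u v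
  proof -
    have "u \<noteq> v" using that \<open>simple_graph E\<close> by (auto simp: simple_graph_def)
    thus ?thesis by (simp add: d_def power2_eq_square algebra_simps)
  qed
  have form: "(laplacian E y *v f) \<bullet> f = (\<Sum>e\<in>E. y e * d e)" for y
    using laplacian_quadratic_form [OF \<open>simple_graph E\<close>] d by blast
  show ?thesis
  proof
    assume crit: "critical E x \<mu>"
    have deq: "d e = d e'" if e: "e \<in> E" "e' \<in> E" for e e'
    proof -
      \<comment> \<open>Moving weight from \<open>e'\<close> to \<open>e\<close> compares the two
        values of \<open>d\<close>; for \<open>e = e'\<close> the direction is zero.\<close>
      define y where "y = (\<lambda>z. (if z = e then 1 else 0) - (if z = e' then 1 else (0::real)))"
      have "(\<Sum>z\<in>E. y z) = 0" using e by (simp add: y_def sum_subtractf)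
      then obtain b where "eigenvalue_branch E x y \<mu> b" "(b has_real_derivative 0) (at 0)"
        using crit unfolding critical_def by blast
      hence "(laplacian E y *v f) \<bullet> f = 0"
        by (intro eigenvalue_branch_stationary [OF transpose_laplacian simple ev, of b])
          (auto simp: eigenvalue_branch_def laplacian_add_scaleR)
      moreover have "(\<Sum>z\<in>E. y z * d z) = d e - d e'"
        using e by (simp add: y_def left_diff_distrib sum_subtractf if_distrib [of "\<lambda>a. a * _"] cong: if_cong)
      ultimately show ?thesis using form [of y] by simp
    qed
    \<comment> \<open>Any edge can serve as reference; if there is none, the claim is
      vacuous.\<close>
    have "\<bar>f $ u - f $ v\<bar> = sqrt (d (SOME e. e \<in> E))" if "{u, v} \<in> E" for u v
      using d [OF that] deq [OF that someI [of "\<lambda>e. e \<in> E", OF that]] by (metis real_sqrt_abs)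
    thus "\<exists>c. \<forall>u v. {u, v} \<in> E \<longrightarrow> \<bar>f $ u - f $ v\<bar> = c" by blast
  next
    assume "\<exists>c. \<forall>u v. {u, v} \<in> E \<longrightarrow> \<bar>f $ u - f $ v\<bar> = c"
    then obtain c where c: "\<And>u v. {u, v} \<in> E \<Longrightarrow> \<bar>f $ u - f $ v\<bar> = c" by blast
    have dc: "d e = c\<^sup>2" if e: "e \<in> E" for e
    proof -
      obtain u v where "e = {u, v}"
        using e \<open>simple_graph E\<close> by (auto simp: simple_graph_def card_2_iff)
      thus ?thesis using d c e by (metis power2_abs)
    qed
    \<comment> \<open>The analytic branch is built from a unit eigenvector; rescaling preserves the
      vanishing of the form.\<close>
    define g where "g = f /\<^sub>R norm f"
    have f0: "f \<noteq> 0" using ev by (simp add: eigenvector_def)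
    have g: "eigenvector (laplacian E x) \<mu> g" "norm g = 1"
      using ev f0 by (auto simp: g_def eigenvector_def matrix_vector_mult_scaleR)
    show "critical E x \<mu>"
      unfolding critical_def
    proof (intro allI impI)
      fix y :: "'v set \<Rightarrow> real"
      assume y: "(\<Sum>e\<in>E. y e) = 0"
      have "(\<Sum>e\<in>E. y e * d e) = (\<Sum>e\<in>E. y e) * c\<^sup>2"
        by (simp add: dc sum_distrib_right)
      hence "(laplacian E y *v f) \<bullet> f = 0" using form [of y] y by simp
      hence "(laplacian E y *v g) \<bullet> g = 0"
        by (simp add: g_def matrix_vector_mult_scaleR)
      thus "\<exists>b. eigenvalue_branch E x y \<mu> b \<and> (b has_real_derivative 0) (at 0)"
        using analytic_eigenvalue_branch [OF transpose_laplacian simple g, of "laplacian E y"]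
        by (auto simp: eigenvalue_branch_def laplacian_add_scaleR)
    qed
  qed
qed

end
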